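(* Let $(A,\cdot_A,\Delta_r)$ be a factorizable perm bialgebra and let $\lambda\in\mathbb K$, $\lambda\neq0$. Let $\mathfrak B$ be the bilinear form on $A$ defined by $$\mathfrak B(a,b)=-\lambda\langle T_{r-\sigma(r)}^{-1}(a),b\rangle,\quad\forall a,b\in A,$$ and let $P:A\to A$ be the linear map defined by $P(a)=T_r\mathfrak B^\sharp(a)$ for all $a\in A$. Then $(A,\cdot_A,\mathfrak B,P)$ is a quadratic Rota-Baxter perm algebra of weight $\lambda$.
   Context: Conventions: the base field $\mathbb K$ has characteristic zero; all vector spaces and algebras are finite-dimensional. For a bilinear operation $\cdot_A$ on $A$: $L(a)b=a\cdot_A b$, $R(a)b=b\cdot_A a$, $\mathrm{ad}(a)=L(a)-R(a)$. $\sigma(u\otimes v)=v\otimes u$. Perm algebra: a vector space $A$ with bilinear $\cdot_A$ such that $a\cdot_A(b\cdot_A c)=(a\cdot_A b)\cdot_A c=(b\cdot_A a)\cdot_A c$ for all $a,b,c\in A$. Perm coalgebra: $(A,\Delta)$ with $\Delta:A\to A\otimes A$ linear and $(\Delta\otimes\mathrm{id})\Delta=(\mathrm{id}\otimes\Delta)\Delta=(\sigma\otimes\mathrm{id})(\Delta\otimes\mathrm{id})\Delta$. Perm bialgebra: $(A,\cdot_A,\Delta)$ with $(A,\cdot_A)$ a perm algebra, $(A,\Delta)$ a perm coalgebra, and for all $a,b\in A$: $\Delta(a\cdot_A b)=(\mathrm{ad}(a)\otimes\mathrm{id})\Delta(b)+(\mathrm{id}\otimes R(b))\Delta(a)$;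 $\sigma(R(b)\otimes\mathrm{id})\Delta(a)=(R(a)\otimes\mathrm{id})\Delta(b)$; $\Delta(a\cdot_A b)=(\mathrm{id}\otimes L(a))\Delta(b)+(\mathrm{ad}(b)\otimes\mathrm{id})(\Delta(a)-\sigma\Delta(a))$. For $r=\sum_i a_i\otimes b_i\in A\otimes A$: $T_r:A^*\to A$, $T_r(a^* )=\sum_i\langle a^*,a_i\rangle b_i$; $\Delta_r(a)=(\mathrm{id}\otimes R(a)-\mathrm{ad}(a)\otimes\mathrm{id})(r)$. $r$ is a solution of the perm Yang-Baxter equation in $(A,\cdot_A)$ if $\sum_{i,j}\big(a_i\otimes b_i\cdot_A a_j\otimes b_j-a_i\otimes a_j\otimes b_i\cdot_A b_j+a_i\cdot_A a_j\otimes b_i\otimes b_j-a_j\cdot_A a_i\otimes b_i\otimes b_j\big)=0$. $s\in A\otimes A$ is $(R,\mathrm{ad})$-invariant if $(\mathrm{id}\otimes R(a)-\mathrm{ad}(a)\otimes\mathrm{id})(s)=0$ for all $a\in A$. Quasi-triangular perm bialgebra: a perm bialgebra $(A,\cdot_A,\Delta_r)$ where $r$ solves the perm Yang-Baxter equation and $\frac12(r-\sigma(r))$ is $(R,\mathrm{ad})$-invariant. It is factorizable if moreover $T_{r-\sigma(r)}:A^*\to A$ is a linear isomorphism. A bilinear form $\mathfrak B$ on a perm algebra is invariant if $\mathfrak B(a\cdot_A b,c)=\mathfrak B(a,b\cdot_A c-c\cdot_A b)$. A quadratic perm algebra $(A,\cdot_A,\mathfrak B)$ is a perm algebra with a nondegenerate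 skew-symmetric invariant bilinear form; $\mathfrak B^\sharp:A\to A^*$ is $\langle\mathfrak B^\sharp(a),b\rangle=\mathfrak B(a,b)$. A Rota-Baxter operator of weight $\lambda$ on $(A,\cdot_A)$ is a linear map $P:A\to A$ with $P(a)\cdot_A P(b)=P(P(a)\cdot_A b+a\cdot_A P(b)+\lambda a\cdot_A b)$. A quadratic Rota-Baxter perm algebra of weight $\lambda$ is $(A,\cdot_A,\mathfrak B,P)$ with $(A,\cdot_A,\mathfrak B)$ a quadratic perm algebra and $P$ a Rota-Baxter operator of weight $\lambda$ such that $\mathfrak B(P(a),b)+\mathfrak B(a,P(b))+\lambda\mathfrak B(a,b)=0$ for all $a,b\in A$. *)

theory Defs
  imports Complex_Main "HOL-Library.Function_Algebras"
begin

text \<open>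
  A vector space over a field \<open>'k\<close> is a scalar multiplication \<open>scale :: 'k \<Rightarrow> 'a \<Rightarrow> 'a\<close> satisfying
  \<^locale>\<open>vector_space\<close> (resp. \<^locale>\<open>finite_dimensional_vector_space\<close>); the space is the whole type \<open>'a\<close>.
  The \<open>'k\<close>-valued functions on a type are a vector space under \<open>fscale\<close>; both the dual space and the
  tensor powers below live inside such function spaces.
\<close>

definition fscale :: "'k::times \<Rightarrow> ('x \<Rightarrow> 'k) \<Rightarrow> 'x \<Rightarrow> 'k" where
  "fscale c t = (\<lambda>x. c * t x)"

definition bilinear_map ::
  "('k::field \<Rightarrow> 'a::ab_group_add \<Rightarrow> 'a) \<Rightarrow> ('k \<Rightarrow> 'c::ab_group_add \<Rightarrow> 'c) \<Rightarrow> ('a \<Rightarrow> 'a \<Rightarrow> 'c) \<Rightarrow> bool" where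
  "bilinear_map s s' h \<longleftrightarrow>
     (\<forall>x. Vector_Spaces.linear s s' (\<lambda>y. h x y)) \<and>
     (\<forall>y. Vector_Spaces.linear s s' (\<lambda>x. h x y))"

definition trilinear_map ::
  "('k::field \<Rightarrow> 'a::ab_group_add \<Rightarrow> 'a) \<Rightarrow> ('k \<Rightarrow> 'c::ab_group_add \<Rightarrow> 'c) \<Rightarrow> ('a \<Rightarrow> 'a \<Rightarrow> 'a \<Rightarrow> 'c) \<Rightarrow> bool" where
  "trilinear_map s s' h \<longleftrightarrow>
     (\<forall>x y. Vector_Spaces.linear s s' (\<lambda>z. h x y z)) \<and>
     (\<forall>x z. Vector_Spaces.linear s s' (\<lambda>y. h x y z)) \<and>
     (\<forall>y z. Vector_Spaces.linear s s' (\<lambda>x. h x y z))"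


section \<open>Tensor powers\<close>

text \<open>
  \<open>A \<otimes> A\<close> is realised inside the dual of the space of bilinear forms on \<open>A\<close>: \<open>u \<otimes> v\<close> is evaluation
  of a bilinear form at \<open>(u, v)\<close>, extended by \<open>0\<close> to functions that are not bilinear forms, and
  \<open>A \<otimes> A\<close> is the set of finite sums of such evaluations.  Similarly \<open>A \<otimes> A \<otimes> A\<close> uses trilinear
  forms.  The theorems \<open>tensor_lift_sum_list\<close>, \<open>bilinear_map_tensor\<close> and their threefold analogues
  below are the universal property of the tensor product.
\<close>

type_synonym ('a, 'k) tens2 = "('a \<Rightarrow> 'a \<Rightarrow> 'k) \<Rightarrow> 'k"
type_synonym ('a, 'k) tens3 = "('a \<Rightarrow> 'a \<Rightarrow> 'a \<Rightarrow> 'k) \<Rightarrow> 'k"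

context
  fixes scale :: "'k::field \<Rightarrow> 'a::ab_group_add \<Rightarrow> 'a"
begin

definition dual_space :: "('a \<Rightarrow> 'k) set" where
  "dual_space = {f. Vector_Spaces.linear scale (*) f}"

definition tensor :: "'a \<Rightarrow> 'a \<Rightarrow> ('a, 'k) tens2" (infix "\<otimes>" 75) where
  "u \<otimes> v = (\<lambda>\<beta>. if bilinear_map scale (*) \<beta> then \<beta> u v else 0)"

definition tensor3 :: "'a \<Rightarrow> 'a \<Rightarrow> 'a \<Rightarrow> ('a, 'k) tens3" where
  "tensor3 u v w = (\<lambda>\<tau>. if trilinear_map scale (*) \<tau> then \<tau> u v w else 0)"

definition tensor_space :: "('a, 'k) tens2 set" where
  "tensor_space = range (\<lambda>xs. \<Sum>(u, v)\<leftarrow>xs. u \<otimes> v)"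

text \<open>The linear map on \<open>A \<otimes> A\<close> (resp. \<open>A \<otimes> A \<otimes> A\<close>) induced by a bilinear (trilinear) map \<open>h\<close>.\<close>

definition tensor_lift :: "('a \<Rightarrow> 'a \<Rightarrow> 'c::ab_group_add) \<Rightarrow> ('a, 'k) tens2 \<Rightarrow> 'c" where
  "tensor_lift h t =
     (THE w. \<exists>xs. t = (\<Sum>(u, v)\<leftarrow>xs. u \<otimes> v) \<and> w = (\<Sum>(u, v)\<leftarrow>xs. h u v))"

definition tensor3_lift :: "('a \<Rightarrow> 'a \<Rightarrow> 'a \<Rightarrow> 'c::ab_group_add) \<Rightarrow> ('a, 'k) tens3 \<Rightarrow> 'c" where
  "tensor3_lift h t =
     (THE w. \<exists>xs. t = (\<Sum>(u, v, x)\<leftarrow>xs. tensor3 u v x) \<and> w = (\<Sum>(u, v, x)\<leftarrow>xs. h u v x))"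

definition flip :: "('a, 'k) tens2 \<Rightarrow> ('a, 'k) tens2" where
  "flip = tensor_lift (\<lambda>u v. v \<otimes> u)"

definition tensor_map :: "('a \<Rightarrow> 'a) \<Rightarrow> ('a \<Rightarrow> 'a) \<Rightarrow> ('a, 'k) tens2 \<Rightarrow> ('a, 'k) tens2" where
  "tensor_map f g = tensor_lift (\<lambda>u v. f u \<otimes> g v)"

text \<open>\<open>D \<otimes> id\<close> and \<open>id \<otimes> D\<close> for \<open>D : A \<rightarrow> A \<otimes> A\<close>, and \<open>\<sigma> \<otimes> id\<close> on \<open>A \<otimes> A \<otimes> A\<close>.\<close>

definition comult_left :: "('a \<Rightarrow> ('a, 'k) tens2) \<Rightarrow> ('a, 'k) tens2 \<Rightarrow> ('a, 'k) tens3" where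
  "comult_left D = tensor_lift (\<lambda>u v. tensor_lift (\<lambda>x y. tensor3 x y v) (D u))"

definition comult_right :: "('a \<Rightarrow> ('a, 'k) tens2) \<Rightarrow> ('a, 'k) tens2 \<Rightarrow> ('a, 'k) tens3" where
  "comult_right D = tensor_lift (\<lambda>u v. tensor_lift (\<lambda>x y. tensor3 u x y) (D v))"

definition flip12 :: "('a, 'k) tens3 \<Rightarrow> ('a, 'k) tens3" where
  "flip12 = tensor3_lift (\<lambda>u v w. tensor3 v u w)"

end


section \<open>Perm bialgebras and the perm Yang-Baxter equation\<close>

context
  fixes scale :: "'k::field \<Rightarrow> 'a::ab_group_add \<Rightarrow> 'a"
    and mult :: "'a \<Rightarrow> 'a \<Rightarrow> 'a" (infixl "\<cdot>" 70)
begin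

definition L_op :: "'a \<Rightarrow> 'a \<Rightarrow> 'a" where "L_op a b = a \<cdot> b"
definition R_op :: "'a \<Rightarrow> 'a \<Rightarrow> 'a" where "R_op a b = b \<cdot> a"
definition ad_op :: "'a \<Rightarrow> 'a \<Rightarrow> 'a" where "ad_op a b = L_op a b - R_op a b"

definition perm_algebra :: bool where
  "perm_algebra \<longleftrightarrow> bilinear_map scale scale (\<cdot>) \<and>
     (\<forall>a b c. a \<cdot> (b \<cdot> c) = (a \<cdot> b) \<cdot> c \<and> (a \<cdot> b) \<cdot> c = (b \<cdot> a) \<cdot> c)"

definition perm_coalgebra :: "('a \<Rightarrow> ('a, 'k) tens2) \<Rightarrow> bool" where
  "perm_coalgebra D \<longleftrightarrow>
     Vector_Spaces.linear scale fscale D \<and> range D \<subseteq> tensor_space scale \<and>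
     (\<forall>a. comult_left scale D (D a) = comult_right scale D (D a) \<and>
          comult_right scale D (D a) = flip12 scale (comult_left scale D (D a)))"

definition perm_bialgebra :: "('a \<Rightarrow> ('a, 'k) tens2) \<Rightarrow> bool" where
  "perm_bialgebra D \<longleftrightarrow> perm_algebra \<and> perm_coalgebra D \<and>
     (\<forall>a b.
        D (a \<cdot> b) = tensor_map scale (ad_op a) id (D b) + tensor_map scale id (R_op b) (D a) \<and>
        flip scale (tensor_map scale (R_op b) id (D a)) = tensor_map scale (R_op a) id (D b) \<and>
        D (a \<cdot> b) = tensor_map scale id (L_op a) (D b)
                   + tensor_map scale (ad_op b) id (D a - flip scale (D a)))"

text \<open>In the double sum below, \<open>(a, b)\<close> is the \<open>i\<close>-th and \<open>(a', b')\<close> the \<open>j\<close>-th term of \<open>r\<close>.\<close>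

definition perm_YBE :: "('a, 'k) tens2 \<Rightarrow> bool" where
  "perm_YBE r \<longleftrightarrow>
     tensor_lift scale (\<lambda>a b. tensor_lift scale (\<lambda>a' b'.
         tensor3 scale a (b \<cdot> a') b' - tensor3 scale a a' (b \<cdot> b')
       + tensor3 scale (a \<cdot> a') b b' - tensor3 scale (a' \<cdot> a) b b') r) r = 0"

definition T_map :: "('a, 'k) tens2 \<Rightarrow> ('a \<Rightarrow> 'k) \<Rightarrow> 'a" where
  "T_map r f = tensor_lift scale (\<lambda>a b. scale (f a) b) r"

definition Delta :: "('a, 'k) tens2 \<Rightarrow> 'a \<Rightarrow> ('a, 'k) tens2" where
  "Delta r a = tensor_map scale id (R_op a) r - tensor_map scale (ad_op a) id r"

definition R_ad_invariant :: "('a, 'k) tens2 \<Rightarrow> bool" where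
  "R_ad_invariant s \<longleftrightarrow>
     (\<forall>a. tensor_map scale id (R_op a) s - tensor_map scale (ad_op a) id s = 0)"

definition quasi_triangular_perm_bialgebra :: "('a, 'k) tens2 \<Rightarrow> bool" where
  "quasi_triangular_perm_bialgebra r \<longleftrightarrow>
     r \<in> tensor_space scale \<and> perm_bialgebra (Delta r) \<and> perm_YBE r \<and>
     R_ad_invariant (fscale (1 / 2) (r - flip scale r))"

definition factorizable_perm_bialgebra :: "('a, 'k) tens2 \<Rightarrow> bool" where
  "factorizable_perm_bialgebra r \<longleftrightarrow> quasi_triangular_perm_bialgebra r \<and>
     (let T = T_map (r - flip scale r); A' = dual_space scale in
        (\<forall>f\<in>A'. \<forall>g\<in>A'. T (f + g) = T f + T g) \<and>
        (\<forall>c. \<forall>f\<in>A'. T (fscale c f) = scale c (T f)) \<and>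
        bij_betw T A' UNIV)"


section \<open>Quadratic Rota-Baxter perm algebras\<close>

definition quadratic_perm_algebra :: "('a \<Rightarrow> 'a \<Rightarrow> 'k) \<Rightarrow> bool" where
  "quadratic_perm_algebra B \<longleftrightarrow> perm_algebra \<and> bilinear_map scale (*) B \<and>
     (\<forall>a. (\<forall>b. B a b = 0) \<longrightarrow> a = 0) \<and> (\<forall>b. (\<forall>a. B a b = 0) \<longrightarrow> b = 0) \<and>
     (\<forall>a b. B a b = - B b a) \<and>
     (\<forall>a b c. B (a \<cdot> b) c = B a (b \<cdot> c - c \<cdot> b))"

definition rota_baxter_operator :: "'k \<Rightarrow> ('a \<Rightarrow> 'a) \<Rightarrow> bool" where
  "rota_baxter_operator w P \<longleftrightarrow> Vector_Spaces.linear scale scale P \<and>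
     (\<forall>a b. P a \<cdot> P b = P (P a \<cdot> b + a \<cdot> P b + scale w (a \<cdot> b)))"

definition quadratic_rota_baxter_perm_algebra ::
  "('a \<Rightarrow> 'a \<Rightarrow> 'k) \<Rightarrow> ('a \<Rightarrow> 'a) \<Rightarrow> 'k \<Rightarrow> bool" where
  "quadratic_rota_baxter_perm_algebra B P w \<longleftrightarrow>
     quadratic_perm_algebra B \<and> rota_baxter_operator w P \<and>
     (\<forall>a b. B (P a) b + B a (P b) + w * B a b = 0)"

end

definition sharp :: "('a \<Rightarrow> 'a \<Rightarrow> 'k) \<Rightarrow> 'a \<Rightarrow> 'a \<Rightarrow> 'k" where
  "sharp B a = (\<lambda>b. B a b)"


section \<open>The universal property of the tensor powers\<close>

lemma vector_space_fscale: "vector_space (fscale :: 'k::field \<Rightarrow> ('x \<Rightarrow> 'k) \<Rightarrow> _)"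
  by unfold_locales (auto simp: fscale_def fun_eq_iff algebra_simps)

lemma vector_space_mult: "vector_space ((*) :: 'k::field \<Rightarrow> _)"
  by unfold_locales (auto simp: algebra_simps)

lemma linear_fun_iff:
  "Vector_Spaces.linear s s' f \<longleftrightarrow> vector_space s \<and> vector_space s' \<and>
     (\<forall>x y. f (x + y) = f x + f y) \<and> (\<forall>c x. f (s c x) = s' c (f x))"
  by (auto simp: Vector_Spaces.linear_def module_hom_def module_hom_axioms_def
      module_iff_vector_space)

lemma functionals_separate:
  assumes W: "vector_space (s :: 'k::field \<Rightarrow> 'c::ab_group_add \<Rightarrow> 'c)"
    and eq: "\<And>\<psi>. Vector_Spaces.linear s (*) \<psi> \<Longrightarrow> \<psi> x = \<psi> y"
  shows "x = y"
proof (rule ccontr)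
  assume "x \<noteq> y"
  interpret vector_space_pair s "(*) :: 'k \<Rightarrow> _"
    using W vector_space_mult by (simp add: vector_space_pair_def)
  have ind: "vs1.independent {x - y}"
    using \<open>x \<noteq> y\<close> by simp
  have lin: "Vector_Spaces.linear s (*) (construct {x - y} (\<lambda>_. 1))"
    by (rule linear_construct[OF ind])
  have "construct {x - y} (\<lambda>_. 1) (x - y) = 0"
    unfolding linear_diff[OF lin] using eq[OF lin] by simp
  then show False using construct_basis[OF ind] by simp
qed

lemma linear_compose_fun:
  "Vector_Spaces.linear s s' f \<Longrightarrow> Vector_Spaces.linear s' s'' g \<Longrightarrow>
     Vector_Spaces.linear s s'' (\<lambda>x. g (f x))"
  by (auto simp: linear_fun_iff)

lemma sum_list_fun_apply: "sum_list xs z = (\<Sum>f\<leftarrow>xs. f z)"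
  for xs :: "('x \<Rightarrow> 'y::monoid_add) list"
  by (induction xs) auto

lemma linear_sum_list:
  "Vector_Spaces.linear s s' f \<Longrightarrow> f (sum_list xs) = (\<Sum>x\<leftarrow>xs. f x)"
proof (induction xs)
  case Nil
  then have "f (0 + 0) = f 0 + f 0" unfolding linear_fun_iff by blast
  then show ?case by simp
qed (auto simp: linear_fun_iff)

theorem tensor_lift_sum_list:
  assumes h: "bilinear_map s s' h"
  shows "tensor_lift s h (\<Sum>(u, v)\<leftarrow>xs. tensor s u v) = (\<Sum>(u, v)\<leftarrow>xs. h u v)"
  unfolding tensor_lift_def
proof (rule the_equality)
  fix w
  assume "\<exists>ys. (\<Sum>(u, v)\<leftarrow>xs. tensor s u v) = (\<Sum>(u, v)\<leftarrow>ys. tensor s u v) \<and> w = (\<Sum>(u, v)\<leftarrow>ys. h u v)"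
  then obtain ys where
    eq: "(\<Sum>(u, v)\<leftarrow>xs. tensor s u v) = (\<Sum>(u, v)\<leftarrow>ys. tensor s u v)"
    and w: "w = (\<Sum>(u, v)\<leftarrow>ys. h u v)" by blast
  have W: "vector_space s'" using h by (auto simp: bilinear_map_def linear_fun_iff)
  show "w = (\<Sum>(u, v)\<leftarrow>xs. h u v)"
  proof (rule functionals_separate[OF W])
    fix \<psi> assume \<psi>: "Vector_Spaces.linear s' (*) \<psi>"
    define \<beta> where "\<beta> = (\<lambda>u v. \<psi> (h u v))"
    have \<beta>: "bilinear_map s (*) \<beta>"
      using h linear_compose_fun[OF _ \<psi>] unfolding bilinear_map_def \<beta>_def by blast
    have ev: "\<psi> (\<Sum>(u, v)\<leftarrow>zs. h u v) = (\<Sum>(u, v)\<leftarrow>zs. tensor s u v) \<beta>" for zs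
      by (simp add: linear_sum_list[OF \<psi>] sum_list_fun_apply o_def case_prod_beta
          tensor_def \<beta>) (simp add: \<beta>_def)
    show "\<psi> w = \<psi> (\<Sum>(u, v)\<leftarrow>xs. h u v)"
      unfolding w ev eq ..
  qed
qed blast

theorem tensor3_lift_sum_list:
  assumes h: "trilinear_map s s' h"
  shows "tensor3_lift s h (\<Sum>(u, v, x)\<leftarrow>xs. tensor3 s u v x) = (\<Sum>(u, v, x)\<leftarrow>xs. h u v x)"
  unfolding tensor3_lift_def
proof (rule the_equality)
  fix w
  assume "\<exists>ys. (\<Sum>(u, v, x)\<leftarrow>xs. tensor3 s u v x) = (\<Sum>(u, v, x)\<leftarrow>ys. tensor3 s u v x) \<and>
    w = (\<Sum>(u, v, x)\<leftarrow>ys. h u v x)"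
  then obtain ys where
    eq: "(\<Sum>(u, v, x)\<leftarrow>xs. tensor3 s u v x) = (\<Sum>(u, v, x)\<leftarrow>ys. tensor3 s u v x)"
    and w: "w = (\<Sum>(u, v, x)\<leftarrow>ys. h u v x)" by blast
  have W: "vector_space s'" using h by (auto simp: trilinear_map_def linear_fun_iff)
  show "w = (\<Sum>(u, v, x)\<leftarrow>xs. h u v x)"
  proof (rule functionals_separate[OF W])
    fix \<psi> assume \<psi>: "Vector_Spaces.linear s' (*) \<psi>"
    define \<beta> where "\<beta> = (\<lambda>u v x. \<psi> (h u v x))"
    have \<beta>: "trilinear_map s (*) \<beta>"
      using h linear_compose_fun[OF _ \<psi>] unfolding trilinear_map_def \<beta>_def by blast
    have ev: "\<psi> (\<Sum>(u, v, x)\<leftarrow>zs. h u v x) = (\<Sum>(u, v, x)\<leftarrow>zs. tensor3 s u v x) \<beta>" for zs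
      by (simp add: linear_sum_list[OF \<psi>] sum_list_fun_apply o_def case_prod_beta
          tensor3_def \<beta>) (simp add: \<beta>_def)
    show "\<psi> w = \<psi> (\<Sum>(u, v, x)\<leftarrow>xs. h u v x)"
      unfolding w ev eq ..
  qed
qed blast

theorem bilinear_map_tensor:
  assumes "vector_space s"
  shows "bilinear_map s fscale (tensor s)"
  using assms vector_space_fscale
  by (auto simp: bilinear_map_def linear_fun_iff tensor_def fscale_def fun_eq_iff)

theorem trilinear_map_tensor3:
  assumes "vector_space s"
  shows "trilinear_map s fscale (tensor3 s)"
  using assms vector_space_fscale
  by (auto simp: trilinear_map_def linear_fun_iff tensor3_def fscale_def fun_eq_iff)

end

theory Submission
  imports Defs
begin

text \<open>
  Write \<open>T = T\<^sub>r\<close>, \<open>T'\<close> for the map of the flipped tensor, and \<open>S = T - T'\<close>, so that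
  \<open>g (T f) = f (T' g)\<close> and \<open>S\<close> is skew. Every element of \<open>A\<close> is some \<open>S f\<close>, where
  \<open>B (S f) b = - \<lambda> f b\<close> and \<open>P (S f) = - \<lambda> T f\<close>; skew symmetry of \<open>B\<close> and its compatibility with
  \<open>P\<close> are then duality of \<open>T\<close> and \<open>T'\<close>. The invariance of \<open>r - \<sigma> r\<close> says \<open>S f \<cdot> a = S (f \<circ> ad a)\<close>
  (invariance of \<open>B\<close>), and by skewness also \<open>a \<cdot> S f = S (f \<circ> L a)\<close>. The perm Yang-Baxter equation
  says \<open>T f \<cdot> T g = T (g \<circ> L (T f) + f \<circ> ad (T' g))\<close>, and the Rota-Baxter identity follows since
  \<open>S (g \<circ> L (T f) + f \<circ> ad (T' g)) = T f \<cdot> S g + S f \<cdot> T' g\<close>.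
\<close>

section \<open>Tensors as functionals on bilinear forms\<close>

lemma bilinear_mapI:
  assumes "vector_space s" "vector_space s'"
    and "\<And>x y z. h (x + y) z = h x z + h y z" "\<And>x y z. h z (x + y) = h z x + h z y"
    and "\<And>c x y. h (s c x) y = s' c (h x y)" "\<And>c x y. h x (s c y) = s' c (h x y)"
  shows "bilinear_map s s' h"
  using assms by (simp add: bilinear_map_def linear_fun_iff)

lemma tensor_spaceE:
  assumes "t \<in> tensor_space s"
  obtains xs where "t = (\<Sum>(u, v)\<leftarrow>xs. tensor s u v)"
  using assms by (auto simp: tensor_space_def)

lemma sum_list_tensor_apply:
  "bilinear_map s (*) \<beta> \<Longrightarrow> (\<Sum>(u, v)\<leftarrow>xs. tensor s u v) \<beta> = (\<Sum>(u, v)\<leftarrow>xs. \<beta> u v)"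
  by (induction xs) (auto simp: tensor_def)

text \<open>Turns identities between lifted elements into identities between values of
  \<open>t\<close> at bilinear forms: both sides give the same sum of scalars on a list of pure
  tensors representing \<open>t\<close>.\<close>

lemma functional_tensor_lift:
  assumes "t \<in> tensor_space s" "bilinear_map s s' h" "Vector_Spaces.linear s' (*) \<psi>"
  shows "\<psi> (tensor_lift s h t) = t (\<lambda>u v. \<psi> (h u v))"
proof -
  obtain xs where t: "t = (\<Sum>(u, v)\<leftarrow>xs. tensor s u v)"
    using assms(1) by (rule tensor_spaceE)
  have "bilinear_map s (*) (\<lambda>u v. \<psi> (h u v))"
    using assms(2) linear_compose_fun[OF _ assms(3)] unfolding bilinear_map_def by blast
  then show ?thesis
    unfolding t tensor_lift_sum_list[OF assms(2)]
    by (simp add: sum_list_tensor_apply linear_sum_list[OF assms(3)] o_def)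
      (simp add: case_prod_beta')
qed

text \<open>For nested lifts, this makes the inner lift linear in the outer variables. The list
  representing \<open>t\<close> does not depend on the parameter, so linearity is checked term by
  term.\<close>

lemma linear_tensor_lift_param:
  assumes "t \<in> tensor_space s" "vector_space s\<^sub>0" "vector_space s'"
    and "\<And>y. bilinear_map s s' (h y)"
    and "\<And>u v. Vector_Spaces.linear s\<^sub>0 s' (\<lambda>y. h y u v)"
  shows "Vector_Spaces.linear s\<^sub>0 s' (\<lambda>y. tensor_lift s (h y) t)"
proof -
  interpret V: vector_space s' by fact
  obtain xs where t: "t = (\<Sum>(u, v)\<leftarrow>xs. tensor s u v)"
    using assms(1) by (rule tensor_spaceE)
  have "Vector_Spaces.linear s\<^sub>0 s' (\<lambda>y. \<Sum>(u, v)\<leftarrow>xs. h y u v)"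
    using assms(2,3,5)
    by (induction xs) (auto simp: linear_fun_iff V.scale_right_distrib algebra_simps)
  then show ?thesis
    unfolding t by (simp add: tensor_lift_sum_list[OF assms(4)])
qed

text \<open>Bilinearity of both summands is essential: \<open>tensor\<close> gives 0 on functions
  that are not bilinear, while two such functions may have a bilinear sum.\<close>

lemma tensor_apply_add:
  assumes "t \<in> tensor_space s" "bilinear_map s (*) \<beta>" "bilinear_map s (*) \<gamma>"
  shows "t (\<lambda>u v. \<beta> u v + \<gamma> u v) = t \<beta> + t \<gamma>"
proof -
  obtain xs where t: "t = (\<Sum>(u, v)\<leftarrow>xs. tensor s u v)"
    using assms(1) by (rule tensor_spaceE)
  have "bilinear_map s (*) (\<lambda>u v. \<beta> u v + \<gamma> u v)"
    using assms(2,3) by (auto simp: bilinear_map_def linear_fun_iff algebra_simps)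
  then show ?thesis
    using assms(2,3) unfolding t
    by (simp add: sum_list_tensor_apply) (simp add: sum_list_addf case_prod_beta')
qed

lemma tensor_apply_scale:
  assumes "t \<in> tensor_space s" "bilinear_map s (*) \<beta>"
  shows "t (\<lambda>u v. c * \<beta> u v) = c * t \<beta>"
proof -
  obtain xs where t: "t = (\<Sum>(u, v)\<leftarrow>xs. tensor s u v)"
    using assms(1) by (rule tensor_spaceE)
  have "bilinear_map s (*) (\<lambda>u v. c * \<beta> u v)"
    using assms(2) by (auto simp: bilinear_map_def linear_fun_iff algebra_simps)
  then show ?thesis
    using assms(2) unfolding t
    by (simp add: sum_list_tensor_apply) (simp add: sum_list_const_mult case_prod_beta')
qed

lemma tensor_apply_diff:
  assumes "t \<in> tensor_space s" "bilinear_map s (*) \<beta>" "bilinear_map s (*) \<gamma>"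
  shows "t (\<lambda>u v. \<beta> u v - \<gamma> u v) = t \<beta> - t \<gamma>"
proof -
  have "bilinear_map s (*) (\<lambda>u v. - 1 * \<gamma> u v)"
    using assms(3) by (auto simp: bilinear_map_def linear_fun_iff algebra_simps)
  from tensor_apply_add[OF assms(1,2) this] show ?thesis
    by (simp add: tensor_apply_scale[OF assms(1,3), of "- 1", simplified])
qed

text \<open>Scalar counterpart of \<open>linear_tensor_lift_param\<close>: contracting one tensor
  leaves a linear functional of the remaining variable.\<close>

lemma linear_tensor_apply_param:
  assumes "t \<in> tensor_space s" "vector_space s\<^sub>0"
    and "\<And>y. bilinear_map s (*) (h y)"
    and "\<And>u v. Vector_Spaces.linear s\<^sub>0 (*) (\<lambda>y. h y u v)"
  shows "Vector_Spaces.linear s\<^sub>0 (*) (\<lambda>y. t (h y))"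
proof -
  have "h (x + y) = (\<lambda>u v. h x u v + h y u v)" "h (s\<^sub>0 c x) = (\<lambda>u v. c * h x u v)" for x y c
    using assms(4) by (auto simp: linear_fun_iff fun_eq_iff)
  then show ?thesis
    using assms(2) vector_space_mult
    by (simp add: linear_fun_iff tensor_apply_add[OF assms(1,3,3)] tensor_apply_scale[OF assms(1,3)])
qed

text \<open>The functional to use in \<open>functional_tensor_lift\<close> when the lift itself
  takes values in a tensor power.\<close>

lemma linear_apply: "Vector_Spaces.linear fscale (*) (\<lambda>t :: 'x \<Rightarrow> 'k::field. t x)"
  using vector_space_fscale vector_space_mult by (simp add: linear_fun_iff fscale_def)

section \<open>Dual space, tensor maps and the operators \<open>T_map\<close> over a vector
  space\<close>

context vector_space
begin

lemma dual_add: "f \<in> dual_space scale \<Longrightarrow> f (x + y) = f x + f y"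
  and dual_scale: "f \<in> dual_space scale \<Longrightarrow> f (scale c x) = c * f x"
  by (auto simp: dual_space_def linear_fun_iff)

lemma dual_diff: "f \<in> dual_space scale \<Longrightarrow> f (x - y) = f x - f y"
  using dual_add[of f "x - y" y] by simp

lemma dual_spaceI:
  "(\<And>x y. f (x + y) = f x + f y) \<Longrightarrow> (\<And>c x. f (scale c x) = c * f x) \<Longrightarrow> f \<in> dual_space scale"
  using vector_space_axioms vector_space_mult by (simp add: dual_space_def linear_fun_iff)

lemma dual_separates: "(\<And>f. f \<in> dual_space scale \<Longrightarrow> f x = f y) \<Longrightarrow> x = y"
  by (rule functionals_separate[OF vector_space_axioms]) (simp add: dual_space_def)

lemma dual_space_add: "f \<in> dual_space scale \<Longrightarrow> g \<in> dual_space scale \<Longrightarrow> f + g \<in> dual_space scale"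
  by (rule dual_spaceI) (simp_all add: dual_add dual_scale algebra_simps)

lemma dual_space_fscale: "f \<in> dual_space scale \<Longrightarrow> fscale c f \<in> dual_space scale"
  by (rule dual_spaceI) (simp_all add: dual_add dual_scale fscale_def algebra_simps)

lemma bilinear_formI:
  assumes "\<And>x y z. h (x + y) z = h x z + h y z" "\<And>x y z. h z (x + y) = h z x + h z y"
    and "\<And>c x y. h (scale c x) y = c * h x y" "\<And>c x y. h x (scale c y) = c * h x y"
  shows "bilinear_map scale (*) h"
  by (rule bilinear_mapI) (use vector_space_axioms vector_space_mult assms in auto)

lemma bilinear_tensor_maps:
  assumes "Vector_Spaces.linear scale scale p" "Vector_Spaces.linear scale scale q"
  shows "bilinear_map scale fscale (\<lambda>u v. tensor scale (p u) (q v))"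
  using bilinear_map_tensor[OF vector_space_axioms] assms
  by (auto simp: bilinear_map_def linear_fun_iff)

lemma tensor_map_apply:
  assumes "t \<in> tensor_space scale" "bilinear_map scale (*) \<beta>"
    and "Vector_Spaces.linear scale scale p" "Vector_Spaces.linear scale scale q"
  shows "tensor_map scale p q t \<beta> = t (\<lambda>u v. \<beta> (p u) (q v))"
  unfolding tensor_map_def
    functional_tensor_lift[OF assms(1) bilinear_tensor_maps[OF assms(3,4)] linear_apply]
  using assms(2) by (simp add: tensor_def)

lemma bilinear_tensor_swap: "bilinear_map scale fscale (\<lambda>u v. tensor scale v u)"
  using bilinear_map_tensor[OF vector_space_axioms] by (simp add: bilinear_map_def)

lemma flip_apply:
  assumes "t \<in> tensor_space scale" "bilinear_map scale (*) \<beta>"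
  shows "flip scale t \<beta> = t (\<lambda>u v. \<beta> v u)"
  unfolding flip_def functional_tensor_lift[OF assms(1) bilinear_tensor_swap linear_apply]
  using assms(2) by (simp add: tensor_def)

lemma flip_in_tensor_space:
  assumes "t \<in> tensor_space scale"
  shows "flip scale t \<in> tensor_space scale"
proof -
  obtain xs where t: "t = (\<Sum>(u, v)\<leftarrow>xs. tensor scale u v)"
    using assms by (rule tensor_spaceE)
  have "flip scale t = (\<Sum>(u, v)\<leftarrow>map (\<lambda>(u, v). (v, u)) xs. tensor scale u v)"
    unfolding flip_def t tensor_lift_sum_list[OF bilinear_tensor_swap]
    by (simp add: o_def case_prod_beta')
  then show ?thesis unfolding tensor_space_def by (metis rangeI)
qed

lemma tensor_space_add:
  assumes "t \<in> tensor_space scale" "t' \<in> tensor_space scale"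
  shows "t + t' \<in> tensor_space scale"
proof -
  obtain xs ys where "t = (\<Sum>(u, v)\<leftarrow>xs. tensor scale u v)" "t' = (\<Sum>(u, v)\<leftarrow>ys. tensor scale u v)"
    using assms by (auto elim!: tensor_spaceE)
  then have "t + t' = (\<Sum>(u, v)\<leftarrow>xs @ ys. tensor scale u v)" by simp
  then show ?thesis unfolding tensor_space_def by (metis rangeI)
qed

lemma tensor_space_fscale:
  assumes "t \<in> tensor_space scale"
  shows "fscale c t \<in> tensor_space scale"
proof -
  interpret F: vector_space "fscale :: 'a \<Rightarrow> ('b, 'a) tens2 \<Rightarrow> _"
    by (rule vector_space_fscale)
  obtain xs where t: "t = (\<Sum>(u, v)\<leftarrow>xs. tensor scale u v)"
    using assms by (rule tensor_spaceE)
  have "tensor scale (scale c u) v = fscale c (tensor scale u v)" for u v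
    using bilinear_map_tensor[OF vector_space_axioms]
    unfolding bilinear_map_def linear_fun_iff by blast
  then have "fscale c (\<Sum>(u, v)\<leftarrow>xs. tensor scale u v) =
      (\<Sum>(u, v)\<leftarrow>map (\<lambda>(u, v). (scale c u, v)) xs. tensor scale u v)"
    by (induction xs) (auto simp: F.scale_right_distrib)
  then show ?thesis unfolding t tensor_space_def by (metis rangeI)
qed

lemma tensor_space_diff:
  assumes "t \<in> tensor_space scale" "t' \<in> tensor_space scale"
  shows "t - t' \<in> tensor_space scale"
proof -
  have "t - t' = t + fscale (- 1) t'" by (simp add: fscale_def fun_eq_iff)
  then show ?thesis using assms by (simp only: tensor_space_add tensor_space_fscale)
qed

lemma tensor_lift_fscale:
  assumes "t \<in> tensor_space scale" "bilinear_map scale s' h"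
  shows "tensor_lift scale h (fscale c t) = s' c (tensor_lift scale h t)"
proof (rule functionals_separate)
  show "vector_space s'" using assms(2) by (simp add: bilinear_map_def linear_fun_iff)
  fix \<psi> assume \<psi>: "Vector_Spaces.linear s' (*) \<psi>"
  then show "\<psi> (tensor_lift scale h (fscale c t)) = \<psi> (s' c (tensor_lift scale h t))"
    using functional_tensor_lift[OF tensor_space_fscale[OF assms(1)] assms(2) \<psi>]
      functional_tensor_lift[OF assms \<psi>]
    by (simp add: linear_fun_iff fscale_def)
qed

lemma bilinear_T_map:
  "f \<in> dual_space scale \<Longrightarrow> bilinear_map scale scale (\<lambda>u v. scale (f u) v)"
  using vector_space_axioms
  by (intro bilinear_mapI) (auto simp: dual_add dual_scale algebra_simps)

text \<open>The dictionary between a tensor and its operator; with \<open>dual_separates\<close> it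
  reduces operator identities to values of \<open>t\<close> at product forms.\<close>

lemma functional_T_map:
  assumes "t \<in> tensor_space scale" "f \<in> dual_space scale" "g \<in> dual_space scale"
  shows "g (T_map scale t f) = t (\<lambda>u v. f u * g v)"
  unfolding T_map_def
  using functional_tensor_lift[OF assms(1) bilinear_T_map[OF assms(2)], of g] assms(3)
  by (simp add: dual_scale) (simp add: dual_space_def)

lemma bilinear_form_prod:
  "f \<in> dual_space scale \<Longrightarrow> g \<in> dual_space scale \<Longrightarrow> bilinear_map scale (*) (\<lambda>u v. f u * g v)"
  by (rule bilinear_formI) (simp_all add: dual_add dual_scale algebra_simps)

text \<open>Flipping the tensor transposes its operator, since swapping the legs of a product form
  exchanges the two functionals.\<close>

lemma T_map_flip_dual:
  assumes "t \<in> tensor_space scale" "f \<in> dual_space scale" "g \<in> dual_space scale"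
  shows "g (T_map scale (flip scale t) f) = f (T_map scale t g)"
  using assms
  by (simp add: functional_T_map flip_in_tensor_space flip_apply bilinear_form_prod mult.commute)

lemma T_map_diff:
  assumes "t \<in> tensor_space scale" "t' \<in> tensor_space scale" "f \<in> dual_space scale"
  shows "T_map scale (t - t') f = T_map scale t f - T_map scale t' f"
  by (rule dual_separates) (use assms in \<open>simp add: functional_T_map tensor_space_diff dual_diff\<close>)

lemma T_map_fscale:
  assumes "t \<in> tensor_space scale" "f \<in> dual_space scale"
  shows "T_map scale t (fscale c f) = scale c (T_map scale t f)"
proof (rule dual_separates)
  fix g assume g: "g \<in> dual_space scale"
  have "g (T_map scale t (fscale c f)) = t (\<lambda>u v. c * (f u * g v))"
    using functional_T_map[OF assms(1) dual_space_fscale[OF assms(2)] g, of c]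
    by (simp add: fscale_def mult.assoc)
  then show "g (T_map scale t (fscale c f)) = g (scale c (T_map scale t f))"
    using assms g tensor_apply_scale[OF assms(1) bilinear_form_prod[OF assms(2) g], of c]
    by (simp add: functional_T_map dual_scale)
qed

text \<open>Serves to show that \<open>P\<close> is linear, with \<open>F\<close> the map
  \<open>sharp B\<close>.\<close>

lemma linear_T_map_param:
  assumes "t \<in> tensor_space scale" "\<And>y. F y \<in> dual_space scale"
    and "\<And>u. Vector_Spaces.linear scale (*) (\<lambda>y. F y u)"
  shows "Vector_Spaces.linear scale scale (\<lambda>y. T_map scale t (F y))"
  unfolding T_map_def
proof (rule linear_tensor_lift_param[OF assms(1)])
  show "Vector_Spaces.linear scale scale (\<lambda>y. scale (F y u) v)" for u v
    using assms(3)[of u] vector_space_axioms by (simp add: linear_fun_iff scale_left_distrib)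
qed (use vector_space_axioms bilinear_T_map assms(2) in auto)

end


section \<open>The perm Yang-Baxter equation and invariance in operator form\<close>

locale bilinear_algebra = vector_space scale
  for scale :: "'k::field \<Rightarrow> 'a::ab_group_add \<Rightarrow> 'a" +
  fixes mult :: "'a \<Rightarrow> 'a \<Rightarrow> 'a" (infixl "\<cdot>" 70)
  assumes bilinear_mult: "bilinear_map scale scale (\<cdot>)"
begin

lemma mult_add_left: "(x + y) \<cdot> z = x \<cdot> z + y \<cdot> z"
  and mult_add_right: "z \<cdot> (x + y) = z \<cdot> x + z \<cdot> y"
  and mult_scale_left: "scale c x \<cdot> z = scale c (x \<cdot> z)"
  and mult_scale_right: "z \<cdot> scale c x = scale c (z \<cdot> x)"
  using bilinear_mult by (auto simp: bilinear_map_def linear_fun_iff)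

lemmas mult_linear = mult_add_left mult_add_right mult_scale_left mult_scale_right

lemma mult_diff_right: "z \<cdot> (x - y) = z \<cdot> x - z \<cdot> y"
  using mult_add_right[of z "x - y" y] by simp

lemma mult_minus_left: "(- x) \<cdot> z = - (x \<cdot> z)"
  using mult_scale_left[of "- 1" x z] by simp

lemma mult_minus_right: "z \<cdot> (- x) = - (z \<cdot> x)"
  using mult_scale_right[of z "- 1" x] by simp

lemma linear_R_op: "Vector_Spaces.linear scale scale (R_op (\<cdot>) a)"
  and linear_ad_op: "Vector_Spaces.linear scale scale (ad_op (\<cdot>) a)"
  using vector_space_axioms
  by (simp_all add: linear_fun_iff R_op_def ad_op_def L_op_def mult_linear algebra_simps)

lemma linear_id_scale: "Vector_Spaces.linear scale scale id"
  using vector_space_axioms by (simp add: linear_fun_iff)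

lemma dual_L_op:
  assumes "f \<in> dual_space scale" shows "(\<lambda>x. f (a \<cdot> x)) \<in> dual_space scale"
  using assms by (intro dual_spaceI) (simp_all add: mult_linear dual_add dual_scale)

lemma dual_R_op:
  assumes "f \<in> dual_space scale" shows "(\<lambda>x. f (x \<cdot> a)) \<in> dual_space scale"
  using assms by (intro dual_spaceI) (simp_all add: mult_linear dual_add dual_scale)

lemma dual_ad_op:
  assumes "f \<in> dual_space scale" shows "(\<lambda>x. f (a \<cdot> x - x \<cdot> a)) \<in> dual_space scale"
  using assms
  by (intro dual_spaceI) (simp_all add: mult_linear dual_add dual_diff dual_scale algebra_simps)

text \<open>Removes the factor 1/2 that quasi-triangularity puts in front of the skew part of
  \<open>r\<close>; tensor maps commute with scalars.\<close>

lemma R_ad_invariant_fscaleD: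
  assumes "t \<in> tensor_space scale" "R_ad_invariant scale (\<cdot>) (fscale c t)" "c \<noteq> 0"
  shows "R_ad_invariant scale (\<cdot>) t"
proof -
  interpret F: vector_space "fscale :: 'k \<Rightarrow> ('a, 'k) tens2 \<Rightarrow> _"
    by (rule vector_space_fscale)
  have "tensor_map scale p q (fscale c t) = fscale c (tensor_map scale p q t)"
    if "Vector_Spaces.linear scale scale p" "Vector_Spaces.linear scale scale q" for p q
    unfolding tensor_map_def by (rule tensor_lift_fscale[OF assms(1) bilinear_tensor_maps[OF that]])
  then show ?thesis
    using assms(2,3) linear_R_op linear_ad_op linear_id_scale
    by (simp add: R_ad_invariant_def)
qed

text \<open>Pair the invariance equation with \<open>f\<close> on the first leg and \<open>g\<close>
  on the second: \<open>R_op\<close> moves onto \<open>g\<close> and gives the left side,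
  \<open>ad_op\<close> moves onto \<open>f\<close> and gives the right side.\<close>

lemma R_ad_invariant_T_map:
  assumes s: "s \<in> tensor_space scale" and inv: "R_ad_invariant scale (\<cdot>) s"
    and f: "f \<in> dual_space scale"
  shows "T_map scale s f \<cdot> a = T_map scale s (\<lambda>x. f (a \<cdot> x - x \<cdot> a))"
proof (rule dual_separates)
  fix g assume g: "g \<in> dual_space scale"
  let ?\<beta> = "\<lambda>u v. f u * g v"
  have \<beta>: "bilinear_map scale (*) ?\<beta>" using f g by (rule bilinear_form_prod)
  have "tensor_map scale id (R_op (\<cdot>) a) s = tensor_map scale (ad_op (\<cdot>) a) id s"
    using inv by (simp add: R_ad_invariant_def)
  then have "s (\<lambda>u v. f u * g (v \<cdot> a)) = s (\<lambda>u v. f (a \<cdot> u - u \<cdot> a) * g v)"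
    using tensor_map_apply[OF s \<beta> linear_id_scale linear_R_op, of a]
      tensor_map_apply[OF s \<beta> linear_ad_op linear_id_scale, of a]
    by (simp add: R_op_def ad_op_def L_op_def)
  then show "g (T_map scale s f \<cdot> a) = g (T_map scale s (\<lambda>x. f (a \<cdot> x - x \<cdot> a)))"
    using functional_T_map[OF s f dual_R_op[OF g, of a]]
      functional_T_map[OF s dual_ad_op[OF f, of a] g] by simp
qed

text \<open>Pair the equation with \<open>f\<close>, \<open>g\<close>, \<open>h\<close> on the three
  legs. The first term gives the first summand on the right, the second gives the product
  \<open>T f \<cdot> T g\<close>, and the last two combine into the summand with the
  commutator.\<close>

lemma perm_YBE_T_map:
  assumes r: "r \<in> tensor_space scale" and ybe: "perm_YBE scale (\<cdot>) r"
    and f: "f \<in> dual_space scale" and g: "g \<in> dual_space scale"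
  defines "T \<equiv> T_map scale r" and "T' \<equiv> T_map scale (flip scale r)"
  shows "T f \<cdot> T g = T (\<lambda>x. g (T f \<cdot> x)) + T (\<lambda>x. f (T' g \<cdot> x - x \<cdot> T' g))"
proof (rule dual_separates)
  fix h assume h: "h \<in> dual_space scale"
  note lin = mult_linear dual_add[OF f] dual_add[OF g] dual_add[OF h]
    dual_scale[OF f] dual_scale[OF g] dual_scale[OF h]
    dual_diff[OF f] dual_diff[OF g] dual_diff[OF h]
  have linI: "Vector_Spaces.linear scale (*) k"
    if "\<And>x y. k (x + y) = k x + k y" "\<And>c x. k (scale c x) = c * k x" for k :: "'a \<Rightarrow> 'k"
    using dual_spaceI[of k] that by (simp add: dual_space_def)
  have dual_param: "(\<lambda>y. r (F y)) \<in> dual_space scale"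
    if "\<And>y. bilinear_map scale (*) (F y)" "\<And>u v. Vector_Spaces.linear scale (*) (\<lambda>y. F y u v)"
    for F :: "'a \<Rightarrow> 'a \<Rightarrow> 'a \<Rightarrow> 'k"
    using linear_tensor_apply_param[OF r vector_space_axioms that] by (simp add: dual_space_def)
  define q where "q = (\<lambda>a b a' b'. tensor3 scale a (b \<cdot> a') b' - tensor3 scale a a' (b \<cdot> b')
       + tensor3 scale (a \<cdot> a') b b' - tensor3 scale (a' \<cdot> a) b b')"
  \<comment> \<open>The test form for the three legs; the Yang-Baxter element will be evaluated at
    it.\<close>
  define \<tau> where "\<tau> = (\<lambda>x y z. f x * g y * h z)"
  have t3: "bilinear_map scale fscale (\<lambda>u v. tensor3 scale u v w)"
    "bilinear_map scale fscale (\<lambda>u v. tensor3 scale u w v)"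
    "bilinear_map scale fscale (\<lambda>u v. tensor3 scale w u v)" for w
    using trilinear_map_tensor3[OF vector_space_axioms]
    by (auto simp: bilinear_map_def trilinear_map_def)
  have t3': "tensor3 scale (x + y) z w = tensor3 scale x z w + tensor3 scale y z w"
    "tensor3 scale z (x + y) w = tensor3 scale z x w + tensor3 scale z y w"
    "tensor3 scale z w (x + y) = tensor3 scale z w x + tensor3 scale z w y"
    "tensor3 scale (scale c x) z w = fscale c (tensor3 scale x z w)"
    "tensor3 scale z (scale c x) w = fscale c (tensor3 scale z x w)"
    "tensor3 scale z w (scale c x) = fscale c (tensor3 scale z w x)" for x y z w c
    using trilinear_map_tensor3[OF vector_space_axioms]
    by (auto simp: trilinear_map_def linear_fun_iff)
  interpret F: vector_space "fscale :: 'k \<Rightarrow> (('a \<Rightarrow> 'a \<Rightarrow> 'a \<Rightarrow> 'k) \<Rightarrow> 'k) \<Rightarrow> _"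
    by (rule vector_space_fscale)
  have q_inner: "bilinear_map scale fscale (q a b)" for a b
    unfolding q_def
    by (rule bilinear_mapI[OF vector_space_axioms F.vector_space_axioms])
      (simp_all add: mult_linear t3' F.scale_right_distrib F.scale_right_diff_distrib)
  have q_outer: "bilinear_map scale fscale (\<lambda>a b. tensor_lift scale (q a b) r)"
    unfolding bilinear_map_def
  proof (intro conjI allI; rule linear_tensor_lift_param[OF r vector_space_axioms F.vector_space_axioms q_inner])
    show "Vector_Spaces.linear scale fscale (\<lambda>b. q a b u v)" for a u v
      unfolding q_def linear_fun_iff using vector_space_axioms F.vector_space_axioms
      by (auto simp: mult_linear t3' F.scale_right_distrib F.scale_right_diff_distrib)
    show "Vector_Spaces.linear scale fscale (\<lambda>a. q a b u v)" for b u v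
      unfolding q_def linear_fun_iff using vector_space_axioms F.vector_space_axioms
      by (auto simp: mult_linear t3' F.scale_right_distrib F.scale_right_diff_distrib)
  qed
  have \<tau>: "trilinear_map scale (*) \<tau>"
    unfolding trilinear_map_def \<tau>_def by (auto intro!: linI simp: lin algebra_simps)
  \<comment> \<open>The last two terms are merged into one commutator, and each term is grouped so
    that the factor in front depends only on \<open>a\<close> or only on \<open>b\<close>.\<close>
  have q\<tau>: "q a b a' b' \<tau> = f a * (g (b \<cdot> a') * h b') - f a * (g a' * h (b \<cdot> b'))
      + g b * (f (a \<cdot> a' - a' \<cdot> a) * h b')" for a b a' b'
    using \<tau> by (simp add: q_def tensor3_def \<tau>_def lin algebra_simps)

  \<comment> \<open>Contractions over the inner copy of \<open>r\<close>. The first two still depend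
    on the second leg \<open>b\<close> of the outer copy, the third on its first leg
    \<open>a\<close>.\<close>
  define F\<^sub>1 where "F\<^sub>1 = (\<lambda>b. r (\<lambda>a' b'. g (b \<cdot> a') * h b'))"
  define F\<^sub>2 where "F\<^sub>2 = (\<lambda>b. r (\<lambda>a' b'. g a' * h (b \<cdot> b')))"
  define F\<^sub>3 where "F\<^sub>3 = (\<lambda>a. r (\<lambda>a' b'. f (a \<cdot> a' - a' \<cdot> a) * h b'))"
  have b1: "bilinear_map scale (*) (\<lambda>a' b'. g (b \<cdot> a') * h b')"
    and b2: "bilinear_map scale (*) (\<lambda>a' b'. g a' * h (b \<cdot> b'))"
    and b3: "bilinear_map scale (*) (\<lambda>a' b'. f (b \<cdot> a' - a' \<cdot> b) * h b')" for b
    using f g h by (auto intro!: bilinear_form_prod dual_L_op dual_ad_op)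
  have F1: "F\<^sub>1 \<in> dual_space scale"
    unfolding F\<^sub>1_def by (rule dual_param[OF b1], rule linI) (simp_all add: lin algebra_simps)
  have F2: "F\<^sub>2 \<in> dual_space scale"
    unfolding F\<^sub>2_def by (rule dual_param[OF b2], rule linI) (simp_all add: lin algebra_simps)
  have F3: "F\<^sub>3 \<in> dual_space scale"
    unfolding F\<^sub>3_def by (rule dual_param[OF b3], rule linI) (simp_all add: lin algebra_simps)

  have scaled: "bilinear_map scale (*) (\<lambda>u v. c * \<beta> u v)" if "bilinear_map scale (*) \<beta>" for c \<beta>
    using that by (auto simp: bilinear_map_def linear_fun_iff algebra_simps)
  have diff: "bilinear_map scale (*) (\<lambda>u v. \<beta> u v - \<gamma> u v)"
    if "bilinear_map scale (*) \<beta>" "bilinear_map scale (*) \<gamma>" for \<beta> \<gamma>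
    using that by (auto simp: bilinear_map_def linear_fun_iff algebra_simps)
  have inner: "r (\<lambda>a' b'. q a b a' b' \<tau>) = f a * F\<^sub>1 b - f a * F\<^sub>2 b + g b * F\<^sub>3 a" for a b
    unfolding q\<tau> F\<^sub>1_def F\<^sub>2_def F\<^sub>3_def
    by (simp add: tensor_apply_add[OF r] tensor_apply_diff[OF r] tensor_apply_scale[OF r]
        scaled diff b1 b2 b3)
  \<comment> \<open>The form built from \<open>g\<close> and \<open>F\<^sub>3\<close> is needed in
    both argument orders, because its contraction will be read through \<open>flip\<close>.\<close>
  have p: "bilinear_map scale (*) (\<lambda>a b. f a * F\<^sub>1 b)" "bilinear_map scale (*) (\<lambda>a b. f a * F\<^sub>2 b)"
    "bilinear_map scale (*) (\<lambda>b a. g b * F\<^sub>3 a)" "bilinear_map scale (*) (\<lambda>a b. g b * F\<^sub>3 a)"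
    using bilinear_form_prod[OF f F1] bilinear_form_prod[OF f F2] bilinear_form_prod[OF g F3]
      bilinear_form_prod[OF F3 g] by (simp_all add: mult.commute)
  have "0 = tensor_lift scale (\<lambda>a b. tensor_lift scale (q a b) r) r \<tau>"
    using ybe by (simp add: perm_YBE_def q_def)
  also have "\<dots> = r (\<lambda>a b. f a * F\<^sub>1 b - f a * F\<^sub>2 b + g b * F\<^sub>3 a)"
    by (simp add: functional_tensor_lift[OF r q_outer linear_apply]
        functional_tensor_lift[OF r q_inner linear_apply] inner)
  also have "\<dots> = r (\<lambda>a b. f a * F\<^sub>1 b) - r (\<lambda>a b. f a * F\<^sub>2 b) + r (\<lambda>a b. g b * F\<^sub>3 a)"
    by (simp add: tensor_apply_add[OF r] tensor_apply_diff[OF r] diff p)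
  \<comment> \<open>In the last term \<open>g\<close> occupies the second leg and
    \<open>F\<^sub>3\<close> the first, so the contraction gives the operator of the flipped
    tensor.\<close>
  also have "\<dots> = F\<^sub>1 (T f) - F\<^sub>2 (T f) + F\<^sub>3 (T' g)"
    by (simp add: T_def T'_def functional_T_map r f g F1 F2 F3 flip_in_tensor_space flip_apply p)
  also have "F\<^sub>1 (T f) = h (T (\<lambda>x. g (T f \<cdot> x)))"
    unfolding F\<^sub>1_def T_def by (rule functional_T_map[OF r dual_L_op[OF g] h, symmetric])
  also have "F\<^sub>2 (T f) = h (T f \<cdot> T g)"
    unfolding F\<^sub>2_def T_def by (rule functional_T_map[OF r g dual_L_op[OF h], symmetric])
  also have "F\<^sub>3 (T' g) = h (T (\<lambda>x. f (T' g \<cdot> x - x \<cdot> T' g)))"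
    unfolding F\<^sub>3_def T_def by (rule functional_T_map[OF r dual_ad_op[OF f] h, symmetric])
  finally show "h (T f \<cdot> T g) = h (T (\<lambda>x. g (T f \<cdot> x)) + T (\<lambda>x. f (T' g \<cdot> x - x \<cdot> T' g)))"
    by (simp add: dual_add[OF h]) (simp add: algebra_simps)
qed

end


section \<open>Factorizable perm bialgebras\<close>

theorem theorem5p8:
  fixes scale :: "'k::field_char_0 \<Rightarrow> 'a::ab_group_add \<Rightarrow> 'a"
    and Basis :: "'a set"
    and mult :: "'a \<Rightarrow> 'a \<Rightarrow> 'a"
    and r :: "('a, 'k) tens2"
    and lam :: 'k
    and B :: "'a \<Rightarrow> 'a \<Rightarrow> 'k"
    and P :: "'a \<Rightarrow> 'a"
  assumes "finite_dimensional_vector_space scale Basis"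
    and "factorizable_perm_bialgebra scale mult r"
    and "lam \<noteq> 0"
    and "\<And>a b. B a b = - lam * inv_into (dual_space scale) (T_map scale (r - flip scale r)) a b"
    and "\<And>a. P a = T_map scale r (sharp B a)"
  shows "quadratic_rota_baxter_perm_algebra scale mult B P lam"
proof -
  interpret V: vector_space scale
    using assms(1) by (simp add: finite_dimensional_vector_space_def)
  have qt: "quasi_triangular_perm_bialgebra scale mult r"
    using assms(2) by (simp add: factorizable_perm_bialgebra_def)
  then have alg: "perm_algebra scale mult" and r: "r \<in> tensor_space scale"
    and ybe: "perm_YBE scale mult r"
    and half_inv: "R_ad_invariant scale mult (fscale (1 / 2) (r - flip scale r))"
    by (auto simp: quasi_triangular_perm_bialgebra_def perm_bialgebra_def)
  interpret A: bilinear_algebra scale mult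
    using alg by unfold_locales (simp add: perm_algebra_def)

  \<comment> \<open>The operators \<open>T\<close>, \<open>T'\<close>, \<open>S\<close> and their
    duality\<close>
  define D where "D = dual_space scale"
  define s where "s = r - flip scale r"
  define T where "T = T_map scale r"
  define T' where "T' = T_map scale (flip scale r)"
  define S where "S = T_map scale s"
  have fr: "flip scale r \<in> tensor_space scale" using r by (rule V.flip_in_tensor_space)
  have s: "s \<in> tensor_space scale" unfolding s_def using r fr by (rule V.tensor_space_diff)
  have S: "S f = T f - T' f" if "f \<in> D" for f
    using V.T_map_diff[OF r fr] that by (simp add: S_def s_def T_def T'_def D_def)
  have S_add: "S (f + g) = S f + S g" if "f \<in> D" "g \<in> D" for f g
    using assms(2) that by (simp add: factorizable_perm_bialgebra_def Let_def S_def s_def D_def)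
  have S_scale: "S (fscale c f) = scale c (S f)" if "f \<in> D" for c f
    using assms(2) that by (simp add: factorizable_perm_bialgebra_def Let_def S_def s_def D_def)
  have bij: "bij_betw S D UNIV"
    using assms(2) by (simp add: factorizable_perm_bialgebra_def Let_def S_def s_def D_def)
  have surj: "\<exists>f\<in>D. a = S f" for a
    using bij by (auto simp: bij_betw_def)
  \<comment> \<open>On an argument written as \<open>S f\<close> the inverse in the definition of
    \<open>B\<close> cancels; with \<open>surj\<close> this covers all arguments.\<close>
  have B: "B (S f) b = - lam * f b" if "f \<in> D" for f b
    using bij_betw_inv_into_left[OF bij that] assms(4)[of "S f" b]
    by (simp add: S_def s_def D_def)
  have dual: "g (T' f) = f (T g)" if "f \<in> D" "g \<in> D" for f g
    using V.T_map_flip_dual[OF r] that by (simp add: T_def T'_def D_def)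
  have D_diff: "f (x - y) = f x - f y" if "f \<in> D" for f x y
    using V.dual_diff that by (simp add: D_def)
  \<comment> \<open>Transposition exchanges \<open>T\<close> and \<open>T'\<close>, hence changes
    the sign of their difference.\<close>
  have skew: "g (S f) = - f (S g)" if "f \<in> D" "g \<in> D" for f g
    using that by (simp add: S D_diff dual)
  have D_add: "f + g \<in> D" and D_fscale: "fscale c f \<in> D" if "f \<in> D" "g \<in> D" for f g c
    using that V.dual_space_add V.dual_space_fscale by (auto simp: D_def)

  \<comment> \<open>Bilinearity, skew symmetry and nondegeneracy of \<open>B\<close>\<close>
  have B_add_left: "B (x + y) z = B x z + B y z" for x y z
  proof -
    obtain f g where "f \<in> D" "x = S f" "g \<in> D" "y = S g" using surj by metis
    then show ?thesis by (simp flip: S_add add: B D_add algebra_simps)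
  qed
  have B_scale_left: "B (scale c x) z = c * B x z" for c x z
  proof -
    obtain f where "f \<in> D" "x = S f" using surj by metis
    then show ?thesis by (simp flip: S_scale add: B D_fscale) (simp add: fscale_def)
  qed
  have B_skew: "B x y = - B y x" for x y
  proof -
    obtain f g where "f \<in> D" "x = S f" "g \<in> D" "y = S g" using surj by metis
    then show ?thesis using skew[of f g] by (simp add: B)
  qed
  have B_bilinear: "bilinear_map scale (*) B"
  proof (rule V.bilinear_formI)
    \<comment> \<open>Linearity in the second argument is carried over from the first by skew
      symmetry.\<close>
    show "B z (x + y) = B z x + B z y" for x y z
      using B_add_left B_skew[of z] by simp
    show "B x (scale c y) = c * B x y" for c x y
      using B_scale_left B_skew[of x] by simp
  qed (fact B_add_left B_scale_left)+
  have B_nondeg: "a = 0" if "\<And>b. B a b = 0" for a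
  proof -
    obtain f where f: "f \<in> D" "a = S f" using surj by metis
    \<comment> \<open>As \<open>lam\<close> is nonzero, \<open>f\<close> vanishes; written as a zero
      multiple, it is sent to 0 by homogeneity of \<open>S\<close>.\<close>
    have "f = fscale 0 f" using that f assms(3) by (auto simp: B fscale_def)
    then show ?thesis using f S_scale[of f 0] by simp
  qed

  \<comment> \<open>Products with \<open>S f\<close> on either side and invariance of
    \<open>B\<close>\<close>
  have inv: "R_ad_invariant scale mult s"
    using half_inv by (intro A.R_ad_invariant_fscaleD[OF s, of "1 / 2"]) (simp_all add: s_def)
  have right: "mult (S f) a = S (\<lambda>x. f (mult a x - mult x a))" if "f \<in> D" for f a
    using A.R_ad_invariant_T_map[OF s inv] that by (simp add: S_def D_def)
  have D_ops: "(\<lambda>x. f (mult a x - mult x a)) \<in> D" "(\<lambda>x. f (mult a x)) \<in> D" if "f \<in> D" for f a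
    using that A.dual_ad_op A.dual_L_op by (simp_all add: D_def)
  have left: "mult a (S f) = S (\<lambda>x. f (mult a x))" if f: "f \<in> D" for f a
  proof (rule V.dual_separates, fold D_def)
    fix g assume g: "g \<in> D"
    \<comment> \<open>This is \<open>right\<close> rewritten by skewness. Adding its instances for
      \<open>f\<close>, \<open>g\<close> and for \<open>g\<close>, \<open>f\<close> cancels the
      products with \<open>a\<close> on the right and leaves
      \<open>g (mult a (S f)) = - f (mult a (S g))\<close>; one more use of \<open>skew\<close>
      gives the claim.\<close>
    have *: "k (mult (S h) a) = - h (mult a (S k)) + h (mult (S k) a)" if "h \<in> D" "k \<in> D" for h k
      unfolding right[OF that(1)] skew[OF D_ops(1)[OF that(1)] that(2)]
      by (simp add: D_diff that)
    show "g (mult a (S f)) = g (S (\<lambda>x. f (mult a x)))"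
      using *[OF f g] *[OF g f] skew[OF D_ops(2)[OF f] g, of a]
      by (simp add: neg_eq_iff_add_eq_0) (metis neg_eq_iff_add_eq_0 add.inverse_inverse)
  qed

  have B_inv: "B (mult a b) c = B a (mult b c - mult c b)" for a b c
  proof -
    obtain f where "f \<in> D" "a = S f" using surj by metis
    then show ?thesis by (simp add: right B D_ops)
  qed
  \<comment> \<open>Nondegeneracy in the second argument follows from the first by
    \<open>B_skew\<close>.\<close>
  have quad: "quadratic_perm_algebra scale mult B"
    unfolding quadratic_perm_algebra_def
    using alg B_bilinear B_nondeg B_skew B_inv by (metis neg_equal_0_iff_equal)

  \<comment> \<open>Linearity of \<open>P\<close> and the Rota-Baxter identity\<close>
  have sharp_D: "sharp B a \<in> D" for a
    using B_bilinear by (simp add: sharp_def D_def dual_space_def bilinear_map_def)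
  have P_linear: "Vector_Spaces.linear scale scale P"
    unfolding assms(5)
    by (rule V.linear_T_map_param[OF r])
      (use sharp_D B_bilinear in \<open>auto simp: D_def sharp_def bilinear_map_def\<close>)
  have P_add: "P (x + y) = P x + P y" and P_scale: "P (scale c x) = scale c (P x)" for x y c
    using P_linear by (auto simp: linear_fun_iff)
  have P: "P (S f) = scale (- lam) (T f)" if f: "f \<in> D" for f
  proof -
    have "sharp B (S f) = fscale (- lam) f" using f by (simp add: sharp_def fun_eq_iff B fscale_def)
    then show ?thesis
      using V.T_map_fscale[OF r] f by (simp add: assms(5) T_def D_def)
  qed
  have rb: "mult (P a) (P b) = P (mult (P a) b + mult a (P b) + scale lam (mult a b))" for a b
  proof -
    obtain f g where f: "f \<in> D" "a = S f" and g: "g \<in> D" "b = S g" using surj by metis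
    let ?h = "\<lambda>x. g (mult (T f) x)" and ?k = "\<lambda>x. f (mult (T' g) x - mult x (T' g))"
    \<comment> \<open>After factoring out \<open>- lam\<close>, the weight term contributes
      \<open>- mult (S f) (S g)\<close>, which is what turns \<open>T g\<close> into
      \<open>T' g\<close> in the second product.\<close>
    have "mult (P a) b + mult a (P b) + scale lam (mult a b) =
        scale (- lam) (mult (T f) (S g) + mult (S f) (T g - S g))"
      by (simp add: f g P A.mult_linear A.mult_diff_right A.mult_minus_left A.mult_minus_right
          algebra_simps V.scale_right_distrib)
    also have "T g - S g = T' g" using g by (simp add: S)
    also have "mult (T f) (S g) = S ?h" using g by (simp add: left)
    also have "mult (S f) (T' g) = S ?k" using f by (simp add: right)
    finally have "P (mult (P a) b + mult a (P b) + scale lam (mult a b)) =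
        scale (- lam) (scale (- lam) (T ?h + T ?k))"
      using f g by (simp only: P_add P_scale P D_ops) (simp add: algebra_simps)
    also have "T ?h + T ?k = mult (T f) (T g)"
      using A.perm_YBE_T_map[OF r ybe] f g by (simp add: D_def T_def T'_def)
    \<comment> \<open>By bilinearity \<open>mult (P a) (P b)\<close> is likewise
      \<open>mult (T f) (T g)\<close> scaled twice by \<open>- lam\<close>.\<close>
    finally show ?thesis
      using f g by (simp add: P A.mult_linear A.mult_minus_left A.mult_minus_right)
  qed

  \<comment> \<open>Compatibility of \<open>B\<close> and \<open>P\<close>\<close>
  have "B (P a) b + B a (P b) + lam * B a b = 0" for a b
  proof -
    obtain f g where f: "f \<in> D" "a = S f" and g: "g \<in> D" "b = S g" using surj by metis
    have scale_out: "h (scale c x) = c * h x" if "h \<in> D" for h c x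
      using that V.dual_scale by (simp add: D_def)
    \<comment> \<open>The formula for \<open>B\<close> needs a first argument of the form
      \<open>S g\<close>, so \<open>P a\<close> is moved to the second slot.\<close>
    have "B (P a) b = - B b (P a)" by (rule B_skew)
    also have "\<dots> = - lam * lam * g (T f)"
      unfolding f(2) g(2) P[OF f(1)] B[OF g(1)] scale_out[OF g(1)] by simp
    finally have "B (P a) b = - lam * lam * g (T f)" .
    moreover have "B a (P b) = lam * lam * f (T g)"
      unfolding f(2) g(2) P[OF g(1)] B[OF f(1)] scale_out[OF f(1)] by simp
    \<comment> \<open>Expanding \<open>S g\<close> and using duality expresses \<open>B a b\<close>
      by the same two scalars \<open>f (T g)\<close> and \<open>g (T f)\<close>, so that multiplying
      by \<open>lam\<close> cancels the other two terms.\<close>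
    moreover have "B a b = - lam * (f (T g) - g (T f))"
      using f g by (simp add: B) (simp add: S D_diff dual)
    ultimately show ?thesis by (simp only:) (simp add: algebra_simps)
  qed
  then show ?thesis
    unfolding quadratic_rota_baxter_perm_algebra_def rota_baxter_operator_def
    using quad P_linear rb by blast
qed

end
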